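(* Let $\mathcal{A}=\mathcal{A}(V)$ be the arrangement of max-tropical hyperplanes given by a sequence $V=(v_1,\dots,v_n)$ of points in $\mathbb{T}^{d-1}$, and let $J=\operatorname{in}_V(I_{n,d})$ be the initial ideal of $I_{n,d}$ for the weights $V$. Then the Alexander dual of the squarefree monomial ideal $M(J)$ is the fine cotype ideal $I_{\overline{T}(\mathcal{A})}$ of $\mathcal{A}$.
   Context: $\mathbb{T}^{d-1}=\mathbb{R}^d/\mathbb{R}(1,\dots,1)$. For $a\in\mathbb{T}^{d-1}$ the max-tropical hyperplane $H^{\max}(a)$ with apex $a$ has $k$-th closed sector $S_k^{\max}(a)=\{p\in\mathbb{T}^{d-1}: a_k-p_k\le a_j-p_j \text{ for all } j\in[d]\}$, and $\mathcal{A}(V)=(H^{\max}(v_1),\dots,H^{\max}(v_n))$. The fine type of $p\in\mathbb{T}^{d-1}$ is $T_{\mathcal{A}}(p)\in\{0,1\}^{n\times d}$ with $T_{\mathcal{A}}(p)_{ik}=1$ iff $p\in S_k^{\max}(v_i)$; the fine cotype $\overline{T}_{\mathcal{A}}(p)$ is the complementary $0/1$-matrix. For a field $\Bbbk$, the fine cotype ideal is $I_{\overline{T}(\mathcal{A})}=\langle\mathbf{x}^{\overline{T}_{\mathcal{A}}(p)}:p\in\mathbb{T}^{d-1}\rangle\subset\Bbbk[x_{11},\dots,x_{nd}]$, where $\mathbf{x}^T=\prod_{T_{ij}=1}x_{ij}$. $I_{n,d}=\langle x_{ik}x_{jl}-x_{il}x_{jk}: i,j\in[n],\,k,l\in[d]\rangle\subset\Bbbk[x_{11},\dots,x_{nd}]$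 is the ideal of $2\times2$-minors of a general $n\times d$ matrix (the toric ideal of the vertices of $\Delta_{n-1}\times\Delta_{d-1}$). The weight of $x_{ij}$ is $(v_i)_j$ (for chosen representatives in $\mathbb{R}^d$); $\operatorname{in}_V(f)$ is the sum of the terms of $f$ of maximal weight, and $\operatorname{in}_V(I)=\langle\operatorname{in}_V(f):f\in I\rangle$. For an ideal $J$, $M(J)$ is the largest monomial ideal contained in $J$, i.e. the ideal generated by all monomials in $J$. The Alexander dual of a squarefree monomial ideal $I$ with minimal generators $\mathbf{x}^{\sigma}$ is $\bigcap_{\sigma}\langle x_{ij}:(i,j)\in\sigma\rangle$. *)

theory Defs
  imports "HOL-Analysis.Finite_Cartesian_Product" "HOL-Library.Poly_Mapping"
begin

text \<open>
  The index sets \<open>[n]\<close> and \<open>[d]\<close> are rendered as finite types \<open>'n\<close> and \<open>'d\<close>.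
\<close>

definition same_torus_point :: "real ^ 'd::finite \<Rightarrow> real ^ 'd \<Rightarrow> bool" where
  "same_torus_point x y \<longleftrightarrow> (\<exists>c. \<forall>j. x $ j = y $ j + c)"

lemma equivp_same_torus_point: "equivp (same_torus_point :: real ^ 'd::finite \<Rightarrow> _)"
proof (rule equivpI)
  show "reflp (same_torus_point :: real ^ 'd \<Rightarrow> _)"
    by (rule reflpI) (auto simp: same_torus_point_def intro: exI[of _ 0])
  show "symp (same_torus_point :: real ^ 'd \<Rightarrow> _)"
  proof (rule sympI)
    fix x y :: "real ^ 'd"
    assume "same_torus_point x y"
    then obtain c where "\<forall>j. x $ j = y $ j + c"
      by (auto simp: same_torus_point_def)
    then have "\<forall>j. y $ j = x $ j + (- c)" by simp
    then show "same_torus_point y x" unfolding same_torus_point_def by blast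
  qed
  show "transp (same_torus_point :: real ^ 'd \<Rightarrow> _)"
  proof (rule transpI)
    fix x y z :: "real ^ 'd"
    assume "same_torus_point x y" "same_torus_point y z"
    then obtain c e where "\<forall>j. x $ j = y $ j + c" "\<forall>j. y $ j = z $ j + e"
      by (auto simp: same_torus_point_def)
    then have "\<forall>j. x $ j = z $ j + (e + c)" by simp
    then show "same_torus_point x z" unfolding same_torus_point_def by blast
  qed
qed

quotient_type (overloaded) 'd torus = "real ^ ('d::finite)" / same_torus_point
  morphisms rep_torus torus_point
  by (rule equivp_same_torus_point)

lift_definition max_sector :: "'d::finite \<Rightarrow> 'd torus \<Rightarrow> 'd torus \<Rightarrow> bool"
  is "\<lambda>k a p. \<forall>j. a $ k - p $ k \<le> a $ j - p $ j"
  by (fastforce simp: same_torus_point_def)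

definition sector :: "'d::finite \<Rightarrow> 'd torus \<Rightarrow> 'd torus set" where
  "sector k a = {p. max_sector k a p}"

text \<open>An arrangement is given by the sequence of the apices of its hyperplanes.\<close>

definition fine_type :: "('n::finite \<Rightarrow> 'd::finite torus) \<Rightarrow> 'd torus \<Rightarrow> nat ^ 'd ^ 'n" where
  "fine_type V p = (\<chi> i k. if p \<in> sector k (V i) then 1 else 0)"

definition fine_cotype :: "('n::finite \<Rightarrow> 'd::finite torus) \<Rightarrow> 'd torus \<Rightarrow> nat ^ 'd ^ 'n" where
  "fine_cotype V p = (\<chi> i k. 1 - fine_type V p $ i $ k)"

text \<open>
  The polynomial ring in the variables \<open>x\<^sub>v\<close>, where \<open>v\<close> ranges over \<open>'v\<close>: finitely supported
  maps from exponent vectors to coefficients.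
\<close>

type_synonym ('v, 'k) mpoly = "('v \<Rightarrow>\<^sub>0 nat) \<Rightarrow>\<^sub>0 'k"

text \<open>The ideal generated by a set \<open>B\<close> is the span \<open>ideal.span B\<close> in the ring as a module over itself.\<close>

interpretation ideal: module "times :: 'a::comm_ring_1 \<Rightarrow> 'a \<Rightarrow> 'a"
  by unfold_locales (simp_all add: algebra_simps)

definition monomial :: "('v \<Rightarrow>\<^sub>0 nat) \<Rightarrow> ('v, 'k::comm_ring_1) mpoly" where
  "monomial m = Poly_Mapping.single m 1"

definition var :: "'v \<Rightarrow> ('v, 'k::comm_ring_1) mpoly" where
  "var v = monomial (Poly_Mapping.single v 1)"

definition minors_ideal :: "('n::finite \<times> 'd::finite, 'k::field) mpoly set" where
  "minors_ideal = ideal.span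
     {var (i, k) * var (j, l) - var (i, l) * var (j, k) | i j k l. True}"

definition matrix_monomial :: "nat ^ 'd ^ 'n \<Rightarrow> ('n::finite \<times> 'd::finite, 'k::field) mpoly" where
  "matrix_monomial T = (\<Prod>(i, j) | T $ i $ j = 1. var (i, j))"

definition fine_cotype_ideal ::
    "('n::finite \<Rightarrow> 'd::finite torus) \<Rightarrow> ('n \<times> 'd, 'k::field) mpoly set" where
  "fine_cotype_ideal V = ideal.span {matrix_monomial (fine_cotype V p) | p. True}"

definition weight :: "('n::finite \<Rightarrow> real ^ 'd::finite) \<Rightarrow> ('n \<times> 'd \<Rightarrow>\<^sub>0 nat) \<Rightarrow> real" where
  "weight w m = (\<Sum>(i, j)\<in>UNIV. real (Poly_Mapping.lookup m (i, j)) * w i $ j)"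

definition initial_form ::
    "('n::finite \<Rightarrow> real ^ 'd::finite) \<Rightarrow> ('n \<times> 'd, 'k::field) mpoly \<Rightarrow> ('n \<times> 'd, 'k) mpoly" where
  "initial_form w f =
     (\<Sum>m | m \<in> Poly_Mapping.keys f \<and> (\<forall>m'\<in>Poly_Mapping.keys f. weight w m' \<le> weight w m).
        Poly_Mapping.single m (Poly_Mapping.lookup f m))"

definition initial_ideal ::
    "('n::finite \<Rightarrow> real ^ 'd::finite) \<Rightarrow> ('n \<times> 'd, 'k::field) mpoly set \<Rightarrow> ('n \<times> 'd, 'k) mpoly set" where
  "initial_ideal w I = ideal.span (initial_form w ` I)"

definition largest_monomial_ideal :: "('v, 'k::field) mpoly set \<Rightarrow> ('v, 'k) mpoly set" where
  "largest_monomial_ideal J = ideal.span (range monomial \<inter> J)"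

definition squarefree_monomial_ideal :: "('v, 'k::field) mpoly set \<Rightarrow> bool" where
  "squarefree_monomial_ideal I \<longleftrightarrow>
     (\<exists>S. (\<forall>m\<in>S. \<forall>v. Poly_Mapping.lookup m v \<le> 1) \<and> I = ideal.span (monomial ` S))"

text \<open>
  The minimal generators of a monomial ideal are the monomials in it that are minimal with
  respect to divisibility; they are given here by their exponent vectors.
\<close>

definition minimal_generators :: "('v, 'k::field) mpoly set \<Rightarrow> ('v \<Rightarrow>\<^sub>0 nat) set" where
  "minimal_generators I =
     {m. monomial m \<in> I \<and>
         (\<forall>m'. monomial m' \<in> I \<and> (monomial m' :: ('v, 'k) mpoly) dvd monomial m \<longrightarrow> m' = m)}"

text \<open>
  Meaningful for squarefree monomial ideals only, where a minimal generator is the product of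
  the variables in its support. The dual of the zero ideal is the unit ideal (empty intersection).
\<close>

definition alexander_dual :: "('v, 'k::field) mpoly set \<Rightarrow> ('v, 'k) mpoly set" where
  "alexander_dual I = (\<Inter>m\<in>minimal_generators I. ideal.span (var ` Poly_Mapping.keys m))"

end

theory Submission
  imports Defs
begin

text \<open>
  Read an exponent \<open>m\<close> as a nonnegative integer \<open>n \<times> d\<close> matrix. The ideal of \<open>2 \<times> 2\<close> minors is the
  toric ideal of \<open>\<Delta>\<^bsub>n-1\<^esub> \<times> \<Delta>\<^bsub>d-1\<^esub>\<close>: a minor exchanges two monomials with the same row and column sums,
  so every \<open>f\<close> in the ideal has coefficient sum zero over each fibre of matrices with prescribed
  margins, and conversely two monomials in one fibre differ by an element of the ideal.

  Consequently \<open>x\<^sup>m\<close> lies in the initial ideal \<open>J\<close> exactly if \<open>m\<close> does not have minimal weight in its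
  fibre. If \<open>m'\<close> in the fibre is lighter, then \<open>x\<^sup>m\<close> is the initial form of \<open>x\<^sup>m - x\<^sup>m\<^sup>'\<close>. For the other
  direction, the coefficient sum over the minimal elements of a fibre vanishes on all of \<open>J\<close>: if an
  initial form has a term that is minimal in its fibre, this term is both lightest in the fibre and
  heaviest in \<open>f\<close>, so that all terms of \<open>f\<close> in this fibre survive in the initial form
  (\<open>monomial_in_initial_ideal_iff\<close>).

  Having minimal weight in a fibre is optimality in a transportation problem, and duality of linear
  programming says that it holds exactly if there is a point \<open>q\<close> such that each entry \<open>(i, k)\<close> of the
  support of \<open>m\<close> attains the minimum of \<open>w\<^sub>i\<^sub>j - q\<^sub>j\<close> over \<open>j\<close>; that is, the support is contained in the
  fine type of \<open>q\<close> (\<open>minimal_weight_iff\<close>). The dual solution \<open>q\<close> is found as a vector of lengths of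
  shortest paths in a graph on the columns, where a cycle of negative length would be an exchange
  that makes \<open>m\<close> lighter.

  So \<open>x\<^sup>m \<in> J\<close> depends on the support of \<open>m\<close> only, and \<open>M(J)\<close> is the Stanley-Reisner ideal of the
  simplicial complex generated by the fine types. Its Alexander dual is generated by the monomials
  of the complements of the fine types (\<open>alexander_dual_of_face_ideal\<close>), which are the cotypes.
\<close>

section \<open>Monomials and monomial ideals\<close>

lemma monomial_mult: "monomial a * monomial b = (monomial (a + b) :: ('v, 'k::comm_ring_1) mpoly)"
  by (simp add: monomial_def mult_single)

lemma lookup_monomial:
  "Poly_Mapping.lookup (monomial a :: ('v, 'k::comm_ring_1) mpoly) m = (if m = a then 1 else 0)"
  by (auto simp: monomial_def lookup_single when_def)

lemma keys_monomial: "Poly_Mapping.keys (monomial a :: ('v, 'k::comm_ring_1) mpoly) = {a}"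
  by (simp add: monomial_def)

lemma single_eq_times_monomial:
  "Poly_Mapping.single a c = Poly_Mapping.single 0 c * (monomial a :: ('v, 'k::comm_ring_1) mpoly)"
  by (simp add: monomial_def mult_single)

lemma sum_of_terms: "(\<Sum>m\<in>Poly_Mapping.keys f. Poly_Mapping.single m (Poly_Mapping.lookup f m)) = f"
  for f :: "'a \<Rightarrow>\<^sub>0 'b::comm_monoid_add"
proof (rule poly_mapping_eqI)
  fix k
  have "Poly_Mapping.lookup (\<Sum>m\<in>Poly_Mapping.keys f. Poly_Mapping.single m (Poly_Mapping.lookup f m)) k
      = (\<Sum>m\<in>Poly_Mapping.keys f. if m = k then Poly_Mapping.lookup f m else 0)"
    by (auto simp: lookup_sum lookup_single when_def intro!: sum.cong)
  also have "\<dots> = Poly_Mapping.lookup f k"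
    by (auto simp: sum.delta in_keys_iff)
  finally show "Poly_Mapping.lookup (\<Sum>m\<in>Poly_Mapping.keys f.
      Poly_Mapping.single m (Poly_Mapping.lookup f m)) k = Poly_Mapping.lookup f k" .
qed

lemma exponent_add_diff:
  assumes "\<And>v. Poly_Mapping.lookup a v \<le> Poly_Mapping.lookup b v"
  shows "b = (b - a) + (a :: 'v \<Rightarrow>\<^sub>0 nat)"
  by (rule poly_mapping_eqI) (use assms in \<open>simp add: lookup_add lookup_minus\<close>)

lemma monomial_in_ideal_mono:
  assumes "monomial a \<in> ideal.span B" "\<And>v. Poly_Mapping.lookup a v \<le> Poly_Mapping.lookup b v"
  shows "(monomial b :: ('v, 'k::comm_ring_1) mpoly) \<in> ideal.span B"
proof -
  have "(monomial b :: ('v, 'k) mpoly) = monomial (b - a) * monomial a"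
    using exponent_add_diff[OF assms(2)] by (simp add: monomial_mult)
  then show ?thesis using ideal.span_scale[OF assms(1)] by metis
qed

lemma in_ideal_if_monomials_in_ideal:
  assumes "\<And>m. m \<in> Poly_Mapping.keys f \<Longrightarrow> monomial m \<in> ideal.span B"
  shows "(f :: ('v, 'k::comm_ring_1) mpoly) \<in> ideal.span B"
proof -
  have "(\<Sum>m\<in>Poly_Mapping.keys f. Poly_Mapping.single m (Poly_Mapping.lookup f m)) \<in> ideal.span B"
    by (intro ideal.span_sum, subst single_eq_times_monomial, intro ideal.span_scale assms)
  then show ?thesis by (simp add: sum_of_terms)
qed

lemma monomial_dvd_imp_le:
  assumes "(monomial a :: ('v, 'k::comm_ring_1) mpoly) dvd monomial b"
  shows "Poly_Mapping.lookup a v \<le> Poly_Mapping.lookup b v"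
proof -
  obtain g :: "('v, 'k) mpoly" where "monomial b = monomial a * g" using assms by (rule dvdE)
  then have "b \<in> Poly_Mapping.keys (monomial a * g)" by (metis keys_monomial singletonI)
  then obtain c where "b = a + c" using keys_mult[of "monomial a" g] by (auto simp: keys_monomial)
  then show ?thesis by (simp add: lookup_add)
qed

definition squarefree_exponent :: "'v::finite set \<Rightarrow> 'v \<Rightarrow>\<^sub>0 nat" where
  "squarefree_exponent X = (\<Sum>v\<in>X. Poly_Mapping.single v 1)"

lemma lookup_squarefree_exponent:
  "Poly_Mapping.lookup (squarefree_exponent X) v = (if v \<in> X then 1 else 0)"
proof -
  have "Poly_Mapping.lookup (squarefree_exponent X) v = (\<Sum>u\<in>X. if u = v then 1 else 0)"
    by (auto simp: squarefree_exponent_def lookup_sum lookup_single when_def intro!: sum.cong)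
  then show ?thesis by (simp add: sum.delta)
qed

lemma keys_squarefree_exponent: "Poly_Mapping.keys (squarefree_exponent X) = X"
  by (auto simp: in_keys_iff lookup_squarefree_exponent split: if_splits)

lemma prod_var:
  "finite X \<Longrightarrow> (\<Prod>v\<in>X. var v) = (monomial (\<Sum>v\<in>X. Poly_Mapping.single v 1) :: ('v, 'k::comm_ring_1) mpoly)"
  by (induction X rule: finite_induct) (simp_all add: var_def monomial_mult, simp add: monomial_def)

lemma matrix_monomial_eq:
  "matrix_monomial T = (monomial (squarefree_exponent {(i, j). T $ i $ j = 1}) :: ('n::finite \<times> 'd::finite, 'k::field) mpoly)"
proof -
  have "matrix_monomial T = (\<Prod>v\<in>{(i, j). T $ i $ j = 1}. (var v :: ('n \<times> 'd, 'k) mpoly))"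
    unfolding matrix_monomial_def by (rule prod.cong) auto
  then show ?thesis by (simp add: prod_var squarefree_exponent_def)
qed

text \<open>
  An ideal generated by variables is a monomial ideal, so membership is decided term by term: each
  term must be divisible by one of the variables.
\<close>
lemma keys_meet_if_in_span_vars:
  assumes "(f :: ('v, 'k::comm_ring_1) mpoly) \<in> ideal.span (var ` K)" "m \<in> Poly_Mapping.keys f"
  shows "Poly_Mapping.keys m \<inter> K \<noteq> {}"
proof -
  have "\<forall>m\<in>Poly_Mapping.keys f. Poly_Mapping.keys m \<inter> K \<noteq> {}"
    using assms(1)
  proof (induction rule: ideal.span_induct_alt)
    case (step c x y)
    from step(1) obtain v where v: "v \<in> K" "x = var v" by auto
    show ?case
    proof
      fix m assume "m \<in> Poly_Mapping.keys (c * x + y)"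
      then consider "m \<in> Poly_Mapping.keys (c * x)" | "m \<in> Poly_Mapping.keys y"
        using keys_add[of "c * x" y] by blast
      then show "Poly_Mapping.keys m \<inter> K \<noteq> {}"
      proof cases
        case 1
        then obtain a where "m = a + Poly_Mapping.single v 1"
          using keys_mult[of c x] v(2) by (auto simp: var_def keys_monomial)
        then have "v \<in> Poly_Mapping.keys m" by (simp add: in_keys_iff lookup_add)
        then show ?thesis using v(1) by blast
      qed (use step(2) in blast)
    qed
  qed simp
  then show ?thesis using assms(2) by blast
qed

section \<open>Sums of coefficients over a set of exponents\<close>

text \<open>
  These linear functionals detect that a polynomial lies outside an ideal.
\<close>
definition coeff_sum :: "('v \<Rightarrow>\<^sub>0 nat) set \<Rightarrow> ('v, 'k::comm_ring_1) mpoly \<Rightarrow> 'k" where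
  "coeff_sum S f = (\<Sum>m\<in>Poly_Mapping.keys f \<inter> S. Poly_Mapping.lookup f m)"

lemma coeff_sum_superset:
  assumes "finite A" "Poly_Mapping.keys f \<subseteq> A"
  shows "coeff_sum S f = (\<Sum>m\<in>A \<inter> S. Poly_Mapping.lookup f m)"
  unfolding coeff_sum_def
  by (rule sum.mono_neutral_left) (use assms in \<open>auto simp: in_keys_iff\<close>)

lemma coeff_sum_0: "coeff_sum S 0 = 0"
  by (simp add: coeff_sum_def)

lemma coeff_sum_add: "coeff_sum S (f + g) = coeff_sum S f + coeff_sum S g"
proof -
  let ?A = "Poly_Mapping.keys f \<union> Poly_Mapping.keys g"
  have "coeff_sum S h = (\<Sum>m\<in>?A \<inter> S. Poly_Mapping.lookup h m)" if "h \<in> {f, g, f + g}" for h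
    by (rule coeff_sum_superset) (use that keys_add[of f g] in auto)
  then show ?thesis by (simp add: lookup_add sum.distrib)
qed

lemma coeff_sum_diff: "coeff_sum S (f - g) = coeff_sum S f - coeff_sum S g"
  using coeff_sum_add[of S "f - g" g] by simp

lemma coeff_sum_sum: "coeff_sum S (\<Sum>i\<in>X. f i) = (\<Sum>i\<in>X. coeff_sum S (f i))"
  by (induction X rule: infinite_finite_induct) (simp_all add: coeff_sum_0 coeff_sum_add)

lemma coeff_sum_single: "coeff_sum S (Poly_Mapping.single a c) = (if a \<in> S then c else 0)"
  by (subst coeff_sum_superset[of "{a}"]) auto

lemma coeff_sum_single_times:
  "coeff_sum S (Poly_Mapping.single a c * f) = c * coeff_sum {m. a + m \<in> S} f"
proof -
  let ?t = "\<lambda>m. Poly_Mapping.single m (Poly_Mapping.lookup f m)"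
  have "coeff_sum S (Poly_Mapping.single a c * f)
      = coeff_sum S (Poly_Mapping.single a c * (\<Sum>m\<in>Poly_Mapping.keys f. ?t m))"
    by (simp only: sum_of_terms)
  also have "\<dots> = c * coeff_sum {m. a + m \<in> S} (\<Sum>m\<in>Poly_Mapping.keys f. ?t m)"
    by (auto simp: sum_distrib_left mult_single coeff_sum_sum coeff_sum_single intro!: sum.cong)
  finally show ?thesis by (simp only: sum_of_terms)
qed

text \<open>
  Reduces vanishing on an ideal to vanishing on monomial multiples of its generators, which only
  shifts the set of exponents.
\<close>
lemma coeff_sum_times_eq_0:
  assumes "\<And>a. coeff_sum {m. a + m \<in> S} f = 0"
  shows "coeff_sum S (g * f) = 0"
proof -
  have "coeff_sum S ((\<Sum>a\<in>Poly_Mapping.keys g. Poly_Mapping.single a (Poly_Mapping.lookup g a)) * f) = 0"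
    by (simp add: sum_distrib_right coeff_sum_sum coeff_sum_single_times assms)
  then show ?thesis by (simp only: sum_of_terms)
qed

lemma coeff_sum_monomial: "coeff_sum S (monomial a) = (if a \<in> S then 1 else 0)"
  by (simp add: monomial_def coeff_sum_single)

section \<open>Margins and the ideal of minors\<close>

text \<open>
  Row and column sums are packed into a single function, since they are always compared together.
\<close>
definition margins :: "('n::finite \<times> 'd::finite \<Rightarrow>\<^sub>0 nat) \<Rightarrow> 'n + 'd \<Rightarrow> nat" where
  "margins m = (\<lambda>s. case s of Inl i \<Rightarrow> \<Sum>j\<in>UNIV. Poly_Mapping.lookup m (i, j)
                            | Inr j \<Rightarrow> \<Sum>i\<in>UNIV. Poly_Mapping.lookup m (i, j))"

lemma margins_add: "margins (a + b) s = margins a s + margins b s"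
  by (simp add: margins_def lookup_add sum.distrib split: sum.split)

lemma margins_add_cancel: "margins (a + m) = margins (a + m') \<longleftrightarrow> margins m = margins m'"
  by (simp add: fun_eq_iff margins_add)

lemma margins_single:
  "margins (Poly_Mapping.single (i, j) c) s = (if s = Inl i \<or> s = Inr j then c else 0)"
proof -
  have "Poly_Mapping.lookup (Poly_Mapping.single (i, j) c) v = (if v = (i, j) then c else 0)" for v
    by (auto simp: lookup_single when_def)
  then show ?thesis by (auto simp: margins_def split: sum.split)
qed

lemma margins_swap:
  "margins (Poly_Mapping.single (i, k) 1 + Poly_Mapping.single (j, l) 1)
   = margins (Poly_Mapping.single (i, l) 1 + Poly_Mapping.single (j, k) 1)"
  by (auto simp: fun_eq_iff margins_add margins_single)

lemma coeff_sum_fiber_minors_ideal: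
  assumes "f \<in> minors_ideal"
  shows "coeff_sum {m. margins m = \<mu>} f = 0"
  using assms unfolding minors_ideal_def
proof (induction rule: ideal.span_induct_alt)
  case (step c x y)
  from step(1) obtain i j k l where
    x: "x = var (i, k) * var (j, l) - var (i, l) * var (j, k)" by auto
  have "coeff_sum {m. margins (a + m) = \<mu>} x = 0" for a
    using margins_add_cancel[THEN iffD2, OF margins_swap, of a i k j l]
    by (simp add: x var_def monomial_mult coeff_sum_diff coeff_sum_monomial)
  then have "coeff_sum {m. margins m = \<mu>} (c * x) = 0"
    by (intro coeff_sum_times_eq_0) simp
  with step(2) show ?case by (simp add: coeff_sum_add)
qed (rule coeff_sum_0)

lemma margins_pos_iff:
  "margins m (Inl i) > 0 \<longleftrightarrow> (\<exists>j. Poly_Mapping.lookup m (i, j) > 0)"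
  "margins m (Inr j) > 0 \<longleftrightarrow> (\<exists>i. Poly_Mapping.lookup m (i, j) > 0)"
  by (auto simp: margins_def sum_eq_0_iff simp flip: neq0_conv)

lemma remove_key:
  assumes "Poly_Mapping.lookup (m :: 'v \<Rightarrow>\<^sub>0 nat) v > 0"
  obtains r where "m = Poly_Mapping.single v 1 + r"
proof
  show "m = Poly_Mapping.single v 1 + (m - Poly_Mapping.single v 1)"
    by (rule poly_mapping_eqI) (use assms in \<open>auto simp: lookup_add lookup_minus lookup_single when_def\<close>)
qed

text \<open>
  Induction on the total degree. If \<open>m\<close> and \<open>m'\<close> have a variable \<open>x\<^sub>i\<^sub>k\<close> in common, it can be divided out.
  Otherwise take any \<open>x\<^sub>i\<^sub>k\<close> dividing \<open>x\<^sup>m\<close>: as the margins agree, \<open>m'\<close> has a positive entry \<open>(i, l)\<close> in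
  row \<open>i\<close> and \<open>(j, k)\<close> in column \<open>k\<close>, and one minor trades them for \<open>(i, k)\<close> and \<open>(j, l)\<close>, after which
  \<open>x\<^sub>i\<^sub>k\<close> is a common variable.
\<close>
lemma margins_eq_imp_binomial_in_minors_ideal:
  assumes "margins m = margins m'"
  shows "(monomial m - monomial m' :: ('n::finite \<times> 'd::finite, 'k::field) mpoly) \<in> minors_ideal"
  using assms
proof (induction "\<Sum>v\<in>UNIV. Poly_Mapping.lookup m v" arbitrary: m m' rule: less_induct)
  case less
  \<comment> \<open>The second exponent is left general, as this applies to \<open>m'\<close> and to its modification by a minor.\<close>
  have common: "(monomial m - monomial m'' :: ('n \<times> 'd, 'k) mpoly) \<in> minors_ideal"
    if eq: "margins m = margins m''" and v: "Poly_Mapping.lookup m v > 0" "Poly_Mapping.lookup m'' v > 0"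
    for m'' v
  proof -
    obtain r where r: "m = Poly_Mapping.single v 1 + r" using v(1) by (rule remove_key)
    obtain r'' where r'': "m'' = Poly_Mapping.single v 1 + r''" using v(2) by (rule remove_key)
    have "(\<Sum>v\<in>UNIV. Poly_Mapping.lookup r v) < (\<Sum>v\<in>UNIV. Poly_Mapping.lookup m v)"
      by (rule sum_strict_mono_ex1) (simp_all add: r lookup_add, metis lookup_single_eq prod.collapse zero_less_Suc)
    moreover have "margins r = margins r''" using eq by (simp add: r r'' margins_add_cancel)
    ultimately have "(monomial r - monomial r'' :: ('n \<times> 'd, 'k) mpoly) \<in> minors_ideal"
      by (rule less.hyps)
    then have "monomial (Poly_Mapping.single v 1) * (monomial r - monomial r'' :: ('n \<times> 'd, 'k) mpoly) \<in> minors_ideal"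
      unfolding minors_ideal_def by (rule ideal.span_scale)
    then show ?thesis by (simp add: r r'' monomial_mult algebra_simps)
  qed
  show ?case
  proof (cases "m = 0")
    case True
    then have "margins m' s = 0" for s
      using less.prems by (auto simp: margins_def split: sum.split dest: fun_cong[of _ _ s])
    then have "Poly_Mapping.lookup m' (i, j) = 0" for i j using margins_pos_iff(1)[of m' i] by auto
    then have "m' = 0" by (intro poly_mapping_eqI) auto
    then show ?thesis using True by (simp add: minors_ideal_def ideal.span_zero)
  next
    case False
    then obtain i k where ik: "Poly_Mapping.lookup m (i, k) > 0"
      by (metis bot_nat_0.not_eq_extremum lookup_zero poly_mapping_eqI surj_pair)
    have "margins m' (Inl i) > 0" "margins m' (Inr k) > 0"
      using ik less.prems margins_pos_iff by metis+
    then obtain j l where il: "Poly_Mapping.lookup m' (i, l) > 0" and jk: "Poly_Mapping.lookup m' (j, k) > 0"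
      unfolding margins_pos_iff by auto
    show ?thesis
    proof (cases "Poly_Mapping.lookup m' (i, k) > 0")
      case True
      then show ?thesis using common[OF less.prems ik] by blast
    next
      case False
      obtain r1 where r1: "m' = Poly_Mapping.single (i, l) 1 + r1" using il by (rule remove_key)
      have "Poly_Mapping.lookup r1 (j, k) > 0"
        using jk il False by (auto simp: r1 lookup_add lookup_single when_def split: if_splits)
      then obtain r where r: "r1 = Poly_Mapping.single (j, k) 1 + r" by (rule remove_key)
      define m'' where "m'' = r + (Poly_Mapping.single (i, k) 1 + Poly_Mapping.single (j, l) 1)"
      have m': "m' = r + (Poly_Mapping.single (i, l) 1 + Poly_Mapping.single (j, k) 1)"
        by (simp add: r1 r ac_simps)
      have "margins m = margins m''"
        unfolding less.prems m' m''_def margins_add_cancel by (rule margins_swap[symmetric])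
      moreover have "Poly_Mapping.lookup m'' (i, k) > 0" by (simp add: m''_def lookup_add)
      ultimately have "(monomial m - monomial m'' :: ('n \<times> 'd, 'k) mpoly) \<in> minors_ideal"
        using ik by (intro common)
      moreover have "(monomial r * (var (i, k) * var (j, l) - var (i, l) * var (j, k)) :: ('n \<times> 'd, 'k) mpoly)
          \<in> minors_ideal"
        unfolding minors_ideal_def by (intro ideal.span_scale ideal.span_base) auto
      then have "(monomial m'' - monomial m' :: ('n \<times> 'd, 'k) mpoly) \<in> minors_ideal"
        by (simp add: m' m''_def var_def monomial_mult algebra_simps)
      ultimately have "((monomial m - monomial m'') + (monomial m'' - monomial m') :: ('n \<times> 'd, 'k) mpoly) \<in> minors_ideal"
        unfolding minors_ideal_def by (rule ideal.span_add)
      then show ?thesis by simp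
    qed
  qed
qed

section \<open>Monomials of the initial ideal\<close>

lemma weight_add: "weight w (a + b) = weight w a + weight w b"
  by (simp add: weight_def lookup_add case_prod_unfold sum.distrib algebra_simps)

lemma weight_0: "weight w 0 = 0"
  by (simp add: weight_def)

lemma weight_single: "weight w (Poly_Mapping.single (i, j) c) = real c * w i $ j"
proof -
  have "weight w (Poly_Mapping.single (i, j) c) = (\<Sum>v\<in>UNIV. if v = (i, j) then real c * w i $ j else 0)"
    unfolding weight_def by (rule sum.cong) (auto simp: lookup_single when_def split: if_splits)
  then show ?thesis by simp
qed

definition minimal_weight :: "('n::finite \<Rightarrow> real ^ 'd::finite) \<Rightarrow> ('n \<times> 'd \<Rightarrow>\<^sub>0 nat) \<Rightarrow> bool" where
  "minimal_weight w m \<longleftrightarrow> (\<forall>m'. margins m' = margins m \<longrightarrow> weight w m \<le> weight w m')"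

lemma lookup_initial_form:
  "Poly_Mapping.lookup (initial_form w f) m =
     (if \<forall>m'\<in>Poly_Mapping.keys f. weight w m' \<le> weight w m then Poly_Mapping.lookup f m else 0)"
proof -
  let ?K = "{m \<in> Poly_Mapping.keys f. \<forall>m'\<in>Poly_Mapping.keys f. weight w m' \<le> weight w m}"
  have "Poly_Mapping.lookup (initial_form w f) m = (\<Sum>a\<in>?K. if a = m then Poly_Mapping.lookup f a else 0)"
    by (auto simp: initial_form_def lookup_sum lookup_single when_def intro!: sum.cong)
  also have "\<dots> = (if m \<in> ?K then Poly_Mapping.lookup f m else 0)" by (simp add: sum.delta)
  finally show ?thesis by (auto simp: in_keys_iff)
qed

text \<open>
  The shift by \<open>a\<close> accounts for monomial multiples of the initial form. Suppose that some term \<open>m0\<close> of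
  the initial form is counted. It has the largest weight in \<open>f\<close>, and it has the smallest weight in
  its own fibre, since \<open>a + m0\<close> has. Hence all terms of \<open>f\<close> in that fibre have the same weight as \<open>m0\<close>;
  they all occur in the initial form and are all counted, and their coefficients sum to zero.
\<close>
lemma coeff_sum_minimal_initial_form:
  assumes f: "f \<in> minors_ideal"
  shows "coeff_sum {m. margins (a + m) = \<mu> \<and> minimal_weight w (a + m)} (initial_form w f) = 0"
    (is "coeff_sum ?S _ = 0")
proof (cases "Poly_Mapping.keys (initial_form w f) \<inter> ?S = {}")
  case True
  then show ?thesis by (simp add: coeff_sum_def)
next
  case False
  then obtain m0 where m0: "m0 \<in> Poly_Mapping.keys (initial_form w f)"
    and \<mu>: "margins (a + m0) = \<mu>" and min: "minimal_weight w (a + m0)" by auto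
  have max: "weight w m \<le> weight w m0" if "m \<in> Poly_Mapping.keys f" for m
    using m0 that by (auto simp: in_keys_iff lookup_initial_form split: if_splits)
  have w_eq: "weight w m = weight w m0"
    if "m \<in> Poly_Mapping.keys f" "margins m = margins m0" for m
  proof -
    have "weight w (a + m0) \<le> weight w (a + m)"
      using min that(2) margins_add_cancel unfolding minimal_weight_def by blast
    then show ?thesis using max[OF that(1)] by (simp add: weight_add)
  qed
  have "coeff_sum ?S (initial_form w f) = coeff_sum {m. margins m = margins m0} f"
    unfolding coeff_sum_def
  proof (rule sum.cong)
    show "Poly_Mapping.keys (initial_form w f) \<inter> ?S = Poly_Mapping.keys f \<inter> {m. margins m = margins m0}"
    proof (intro set_eqI iffI)
      fix m assume "m \<in> Poly_Mapping.keys (initial_form w f) \<inter> ?S"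
      then show "m \<in> Poly_Mapping.keys f \<inter> {m. margins m = margins m0}"
        using \<mu> margins_add_cancel[of a m m0]
        by (auto simp: in_keys_iff lookup_initial_form split: if_splits)
    next
      fix m assume m: "m \<in> Poly_Mapping.keys f \<inter> {m. margins m = margins m0}"
      then have we: "weight w m = weight w m0" using w_eq by blast
      have ma: "margins (a + m) = margins (a + m0)" using m by (simp add: margins_add_cancel)
      show "m \<in> Poly_Mapping.keys (initial_form w f) \<inter> ?S"
        using m max min we ma \<mu>
        by (auto simp: in_keys_iff lookup_initial_form minimal_weight_def weight_add)
    qed
  next
    fix m assume "m \<in> Poly_Mapping.keys f \<inter> {m. margins m = margins m0}"
    then show "Poly_Mapping.lookup (initial_form w f) m = Poly_Mapping.lookup f m"
      using max w_eq by (simp add: lookup_initial_form)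
  qed
  then show ?thesis using coeff_sum_fiber_minors_ideal[OF f] by simp
qed

lemma coeff_sum_minimal_initial_ideal:
  assumes "f \<in> initial_ideal w minors_ideal"
  shows "coeff_sum {m. margins m = \<mu> \<and> minimal_weight w m} f = 0"
  using assms unfolding initial_ideal_def
proof (induction rule: ideal.span_induct_alt)
  case (step c x y)
  then have "coeff_sum {m. margins m = \<mu> \<and> minimal_weight w m} (c * x) = 0"
    using coeff_sum_minimal_initial_form[where w = w] by (intro coeff_sum_times_eq_0) auto
  with step(2) show ?case by (simp add: coeff_sum_add)
qed (rule coeff_sum_0)

lemma monomial_in_initial_ideal_iff:
  "(monomial m :: ('n::finite \<times> 'd::finite, 'k::field) mpoly) \<in> initial_ideal w minors_ideal
     \<longleftrightarrow> \<not> minimal_weight w m"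
proof
  assume "(monomial m :: ('n \<times> 'd, 'k) mpoly) \<in> initial_ideal w minors_ideal"
  from coeff_sum_minimal_initial_ideal[OF this, of "margins m"] show "\<not> minimal_weight w m"
    by (auto simp: coeff_sum_monomial)
next
  assume "\<not> minimal_weight w m"
  then obtain m' where eq: "margins m' = margins m" and less: "weight w m' < weight w m"
    by (auto simp: minimal_weight_def not_le)
  let ?f = "monomial m - monomial m' :: ('n \<times> 'd, 'k) mpoly"
  have ne: "m \<noteq> m'" using less by auto
  have keys: "Poly_Mapping.keys ?f = {m, m'}"
    using ne by (auto simp: in_keys_iff lookup_minus lookup_monomial split: if_splits)
  have "initial_form w ?f = monomial m"
    using ne less by (intro poly_mapping_eqI) (auto simp: lookup_initial_form keys lookup_minus lookup_monomial)
  moreover have "?f \<in> minors_ideal"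
    using eq by (intro margins_eq_imp_binomial_in_minors_ideal) simp
  ultimately show "(monomial m :: ('n \<times> 'd, 'k) mpoly) \<in> initial_ideal w minors_ideal"
    unfolding initial_ideal_def by (metis ideal.span_base imageI)
qed

section \<open>Minimal weight and potentials\<close>

text \<open>
  Walks are lists in reverse order: the head is the end point, and the consecutive entries \<open>l, k\<close>
  stand for a step from \<open>k\<close> to \<open>l\<close>. The values of \<open>g\<close> may be costs or exponents, so that the entries
  which a walk adds to and removes from a matrix are computed by the same recursion as its cost.
\<close>
fun step_sum :: "('a \<Rightarrow> 'a \<Rightarrow> 'b::comm_monoid_add) \<Rightarrow> 'a list \<Rightarrow> 'b" where
  "step_sum g (l # k # xs) = g k l + step_sum g (k # xs)"
| "step_sum g _ = 0"

lemma step_sum_append: "step_sum g (ys @ l # zs) = step_sum g (ys @ [l]) + step_sum g (l # zs)"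
proof (induction ys)
  case (Cons y ys)
  then show ?case by (cases ys) (simp_all add: ac_simps)
qed simp

text \<open>
  Here \<open>p l\<close> is the least cost of a simple path that ends in \<open>l\<close> and takes all of its steps from
  points in \<open>A\<close>. Prolonging an optimal path to \<open>k\<close> by a step to \<open>l\<close> gives such a path unless \<open>l\<close> was
  visited before; in that case the prolonged path closes a simple cycle at \<open>l\<close>, whose removal does
  not increase the cost.
\<close>
lemma potential_exists:
  fixes c :: "'a::finite \<Rightarrow> 'a \<Rightarrow> real"
  assumes cycle: "\<And>l ys. distinct (ys @ [l]) \<Longrightarrow> set (ys @ [l]) \<subseteq> A \<Longrightarrow> step_sum c (l # ys @ [l]) \<ge> 0"
  shows "\<exists>p. \<forall>k\<in>A. \<forall>l. p l \<le> p k + c k l"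
proof -
  define P where "P l = {xs. distinct (l # xs) \<and> set xs \<subseteq> A}" for l
  define p where "p l = Min ((\<lambda>xs. step_sum c (l # xs)) ` P l)" for l
  have fin: "finite (P l)" for l
    by (rule finite_subset[OF _ finite_subset_distinct[of A]]) (auto simp: P_def)
  have "[] \<in> P l" for l by (simp add: P_def)
  then have ne: "P l \<noteq> {}" for l by blast
  have le: "p l \<le> step_sum c (l # xs)" if "xs \<in> P l" for l xs
    unfolding p_def using fin that by (intro Min_le) auto
  have "p l \<le> p k + c k l" if k: "k \<in> A" for k l
  proof -
    have "p k \<in> (\<lambda>xs. step_sum c (k # xs)) ` P k"
      unfolding p_def using fin ne by (intro Min_in) auto
    then obtain xs where xs: "xs \<in> P k" and pk: "p k = step_sum c (k # xs)" by auto
    show ?thesis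
    proof (cases "l \<in> set (k # xs)")
      case False
      then have "k # xs \<in> P l" using xs k by (auto simp: P_def)
      from le[OF this] show ?thesis by (simp add: pk)
    next
      case True
      then obtain ys zs where split: "k # xs = ys @ l # zs" by (meson split_list)
      have dist: "distinct (ys @ l # zs)" and sub: "set (ys @ l # zs) \<subseteq> A"
        using xs k by (auto simp: P_def simp flip: split)
      have "step_sum c (l # ys @ [l]) \<ge> 0" using dist sub by (intro cycle) auto
      moreover have "step_sum c (l # ys @ [l]) = c k l + step_sum c (ys @ [l])"
        using split by (cases ys) auto
      moreover have "p k = step_sum c (ys @ [l]) + step_sum c (l # zs)"
        unfolding pk split by (rule step_sum_append)
      moreover have "p l \<le> step_sum c (l # zs)"
        using dist sub by (intro le) (auto simp: P_def)
      ultimately show ?thesis by simp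
    qed
  qed
  then show ?thesis by blast
qed

text \<open>
  The support of the fine type of \<open>q\<close>, in terms of representatives of the torus points.
\<close>
definition tight_entries :: "('n::finite \<Rightarrow> real ^ 'd::finite) \<Rightarrow> real ^ 'd \<Rightarrow> ('n \<times> 'd) set" where
  "tight_entries w q = {(i, k). \<forall>j. w i $ k - q $ k \<le> w i $ j - q $ j}"

text \<open>
  A weight of the form \<open>u\<^sub>i + q\<^sub>j\<close> is constant on each fibre.
\<close>
lemma sum_potential_eq_margins:
  "(\<Sum>(i, j)\<in>UNIV. real (Poly_Mapping.lookup m (i, j)) * (u i + q j))
   = (\<Sum>i\<in>UNIV. real (margins m (Inl i)) * u i) + (\<Sum>j\<in>UNIV. real (margins m (Inr j)) * q j)"
  for m :: "'n::finite \<times> 'd::finite \<Rightarrow>\<^sub>0 nat" and u :: "'n \<Rightarrow> real" and q :: "'d \<Rightarrow> real"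
proof -
  let ?m = "\<lambda>i j. real (Poly_Mapping.lookup m (i, j))"
  have "(\<Sum>(i, j)\<in>UNIV. ?m i j * (u i + q j)) = (\<Sum>i\<in>UNIV. \<Sum>j\<in>UNIV. ?m i j * (u i + q j))"
    by (simp add: sum.cartesian_product flip: UNIV_Times_UNIV)
  also have "\<dots> = (\<Sum>i\<in>UNIV. \<Sum>j\<in>UNIV. ?m i j * u i) + (\<Sum>i\<in>UNIV. \<Sum>j\<in>UNIV. ?m i j * q j)"
    by (simp add: distrib_left sum.distrib)
  also have "(\<Sum>i\<in>UNIV. \<Sum>j\<in>UNIV. ?m i j * q j) = (\<Sum>j\<in>UNIV. \<Sum>i\<in>UNIV. ?m i j * q j)"
    by (rule sum.swap)
  finally show ?thesis by (simp add: margins_def sum_distrib_right)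
qed

text \<open>
  Weak duality: with \<open>u\<^sub>i\<close> the minimum of \<open>w\<^sub>i\<^sub>j - q\<^sub>j\<close> over \<open>j\<close>, the weights are bounded below by
  \<open>u\<^sub>i + q\<^sub>j\<close>, with equality on the support of \<open>m\<close>.
\<close>
lemma minimal_weight_if_tight:
  assumes "Poly_Mapping.keys m \<subseteq> tight_entries w q"
  shows "minimal_weight w m"
  unfolding minimal_weight_def
proof (intro allI impI)
  fix m' assume margins: "margins m' = margins m"
  define u where "u i = Min (range (\<lambda>j. w i $ j - q $ j))" for i
  have le: "u i + q $ j \<le> w i $ j" for i j
  proof -
    have "u i \<le> w i $ j - q $ j" unfolding u_def by (rule Min_le) auto
    then show ?thesis by simp
  qed
  have eq: "w i $ k = u i + q $ k" if "(i, k) \<in> tight_entries w q" for i k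
  proof -
    have "u i = w i $ k - q $ k"
      unfolding u_def by (rule Min_eqI) (use that in \<open>auto simp: tight_entries_def\<close>)
    then show ?thesis by simp
  qed
  have "weight w m = (\<Sum>(i, j)\<in>UNIV. real (Poly_Mapping.lookup m (i, j)) * (u i + q $ j))"
    unfolding weight_def
  proof (rule sum.cong, rule refl, clarify)
    fix i j
    show "real (Poly_Mapping.lookup m (i, j)) * w i $ j = real (Poly_Mapping.lookup m (i, j)) * (u i + q $ j)"
    proof (cases "(i, j) \<in> Poly_Mapping.keys m")
      case True
      then have "w i $ j = u i + q $ j" using assms by (intro eq) blast
      then show ?thesis by simp
    qed (simp add: in_keys_iff)
  qed
  also have "\<dots> = (\<Sum>(i, j)\<in>UNIV. real (Poly_Mapping.lookup m' (i, j)) * (u i + q $ j))"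
    by (simp add: sum_potential_eq_margins margins)
  also have "\<dots> \<le> weight w m'"
    unfolding weight_def by (rule sum_mono) (auto intro!: mult_left_mono le)
  finally show "weight w m \<le> weight w m'" .
qed

text \<open>
  Moving one unit from \<open>(r k l, k)\<close> to \<open>(r k l, l)\<close> for each step from \<open>k\<close> to \<open>l\<close> of a cycle preserves the
  margins and changes the weight by the cost of the cycle. The columns \<open>k\<close> of a simple cycle are
  distinct, so at most one unit is taken from each positive entry and the result is again a
  nonnegative matrix.
\<close>
lemma closed_walk_cost_nonneg:
  assumes min: "minimal_weight w m"
    and r: "\<And>k l. k \<in> A \<Longrightarrow> Poly_Mapping.lookup m (r k l, k) > 0"
    and dist: "distinct (ys @ [l])" and sub: "set (ys @ [l]) \<subseteq> A"
  shows "step_sum (\<lambda>k l. w (r k l) $ l - w (r k l) $ k) (l # ys @ [l]) \<ge> 0"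
proof -
  define D where "D = step_sum (\<lambda>k l. Poly_Mapping.single (r k l, k) (1::nat))"
  define U where "U = step_sum (\<lambda>k l. Poly_Mapping.single (r k l, l) (1::nat))"
  \<comment> \<open>The next three facts are stated for arbitrary lists, so that they can be proved by induction;
      they are used for the cycle only. For a walk that is not closed the margins of the removed and
      of the added entries differ at its two end points.\<close>
  have weight: "weight w (U xs) - weight w (D xs) = step_sum (\<lambda>k l. w (r k l) $ l - w (r k l) $ k) xs" for xs
    unfolding U_def D_def
    by (induction xs rule: induct_list012) (simp_all add: weight_add weight_single weight_0)
  have margins: "margins (U xs) s + (if s = Inr (last xs) then 1 else 0)
      = margins (D xs) s + (if s = Inr (hd xs) then 1 else 0)" if "xs \<noteq> []" for xs s
    using that unfolding U_def D_def
    by (induction xs rule: induct_list012) (auto simp: margins_add margins_single split: if_splits)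
  have below: "Poly_Mapping.lookup (D xs) (i, k) \<le> (if k \<in> set (tl xs) then Poly_Mapping.lookup m (i, k) else 0)"
    if "distinct (tl xs)" "set (tl xs) \<subseteq> A" for xs i k
    using that unfolding D_def
  proof (induction xs rule: induct_list012)
    case (3 l k' xs)
    let ?D = "step_sum (\<lambda>k l. Poly_Mapping.single (r k l, k) (1::nat))"
    have pos: "Poly_Mapping.lookup m (r k' l, k') > 0" using 3(4) by (intro r) auto
    have IH: "Poly_Mapping.lookup (?D (k' # xs)) (i, k)
        \<le> (if k \<in> set xs then Poly_Mapping.lookup m (i, k) else 0)"
      using 3(2-4) by simp
    have D: "Poly_Mapping.lookup (?D (l # k' # xs)) (i, k)
        = (if r k' l = i \<and> k' = k then 1 else 0) + Poly_Mapping.lookup (?D (k' # xs)) (i, k)"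
      by (auto simp: lookup_add lookup_single when_def)
    show ?case
    proof (cases "k = k'")
      case True
      then have "k \<notin> set xs" using 3(3) by simp
      then have "Poly_Mapping.lookup (?D (k' # xs)) (i, k) = 0" using IH by simp
      then show ?thesis unfolding D using True pos by auto
    next
      case False
      then show ?thesis unfolding D using IH by simp
    qed
  qed simp_all
  let ?xs = "l # ys @ [l]"
  have "margins (U ?xs) s = margins (D ?xs) s" for s
    using margins[of ?xs s] by (simp split: if_splits)
  then have same: "margins (R + U ?xs) = margins (R + D ?xs)" for R
    by (simp add: fun_eq_iff margins_add)
  have "Poly_Mapping.lookup (D ?xs) v \<le> Poly_Mapping.lookup m v" for v
    using below[of ?xs "fst v" "snd v"] dist sub by (auto split: if_splits)
  from exponent_add_diff[OF this] obtain R where m: "m = R + D ?xs" by blast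
  have "weight w (R + D ?xs) \<le> weight w (R + U ?xs)"
    using min same unfolding minimal_weight_def m by blast
  then show ?thesis using weight[of ?xs] by (simp add: weight_add)
qed

text \<open>
  Strong duality. The entry \<open>(i, k)\<close> is tight for \<open>q\<close> if \<open>q\<^sub>l \<le> q\<^sub>k + (w\<^sub>i\<^sub>l - w\<^sub>i\<^sub>k)\<close> for all \<open>l\<close>. So \<open>q\<close> must be a
  potential for the graph on the columns in which the step from \<open>k\<close> to \<open>l\<close> costs the least of these
  differences over the rows \<open>i\<close> with a positive entry in column \<open>k\<close>; the row \<open>r k l\<close> attains it.
\<close>
lemma minimal_weight_imp_tight:
  assumes min: "minimal_weight w m"
  shows "\<exists>q. Poly_Mapping.keys m \<subseteq> tight_entries w q"
proof -
  define A where "A = {k. \<exists>i. Poly_Mapping.lookup m (i, k) > 0}"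
  have "\<exists>i. Poly_Mapping.lookup m (i, k) > 0 \<and>
      (\<forall>i'. Poly_Mapping.lookup m (i', k) > 0 \<longrightarrow> w i $ l - w i $ k \<le> w i' $ l - w i' $ k)"
    if "k \<in> A" for k l
  proof -
    let ?R = "{i. Poly_Mapping.lookup m (i, k) > 0}"
    have "?R \<noteq> {}" using that by (simp add: A_def)
    then show ?thesis
      using arg_min_if_finite(1)[of ?R "\<lambda>i. w i $ l - w i $ k"]
        arg_min_least[of ?R _ "\<lambda>i. w i $ l - w i $ k"]
      by (intro exI[of _ "arg_min_on (\<lambda>i. w i $ l - w i $ k) ?R"]) simp
  qed
  then obtain r where r: "\<And>k l. k \<in> A \<Longrightarrow> Poly_Mapping.lookup m (r k l, k) > 0"
    and r_min: "\<And>k l i. k \<in> A \<Longrightarrow> Poly_Mapping.lookup m (i, k) > 0 \<Longrightarrow>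
      w (r k l) $ l - w (r k l) $ k \<le> w i $ l - w i $ k" by metis
  have "\<exists>p. \<forall>k\<in>A. \<forall>l. p l \<le> p k + (w (r k l) $ l - w (r k l) $ k)"
    by (rule potential_exists, rule closed_walk_cost_nonneg[where r = r, OF min r])
  then obtain p where p: "\<forall>k\<in>A. \<forall>l. p l \<le> p k + (w (r k l) $ l - w (r k l) $ k)"
    by blast
  have "Poly_Mapping.keys m \<subseteq> tight_entries w (\<chi> k. p k)"
  proof clarify
    fix i k assume ik: "(i, k) \<in> Poly_Mapping.keys m"
    then have pos: "Poly_Mapping.lookup m (i, k) > 0" by (simp add: in_keys_iff)
    then have "k \<in> A" by (auto simp: A_def)
    have "w i $ k - p k \<le> w i $ l - p l" for l
      using p[rule_format, OF \<open>k \<in> A\<close>, of l] r_min[OF \<open>k \<in> A\<close> pos, of l] by simp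
    then show "(i, k) \<in> tight_entries w (\<chi> k. p k)" by (simp add: tight_entries_def)
  qed
  then show ?thesis by blast
qed

lemma minimal_weight_iff: "minimal_weight w m \<longleftrightarrow> (\<exists>q. Poly_Mapping.keys m \<subseteq> tight_entries w q)"
  using minimal_weight_if_tight minimal_weight_imp_tight by metis

section \<open>Alexander duality\<close>

text \<open>
  The hypothesis says that the monomials of \<open>I\<close> are those of the Stanley-Reisner ideal of the complex
  generated by \<open>\<T>\<close>: their supports are the non-faces. A monomial \<open>x\<^sup>m\<close> lies in the dual if its support
  meets every minimal non-face. Then the complement of the support contains no non-face, so it is
  itself a face, contained in some \<open>t \<in> \<T>\<close>, and \<open>x\<^sup>m\<close> is divisible by the monomial of \<open>- t\<close>. Conversely,
  \<open>- t\<close> meets every non-face.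
\<close>
lemma alexander_dual_of_face_ideal:
  fixes I :: "('v::finite, 'k::field) mpoly set"
  assumes I: "\<And>m. monomial m \<in> I \<longleftrightarrow> (\<forall>t\<in>\<T>. \<not> Poly_Mapping.keys m \<subseteq> t)"
  shows "alexander_dual I = ideal.span {monomial (squarefree_exponent (- t)) | t. t \<in> \<T>}"
    (is "_ = ideal.span ?B")
proof (intro set_eqI iffI)
  fix f assume f: "f \<in> alexander_dual I"
  show "f \<in> ideal.span ?B"
  proof (rule in_ideal_if_monomials_in_ideal)
    fix m assume m: "m \<in> Poly_Mapping.keys f"
    have "\<exists>t\<in>\<T>. - Poly_Mapping.keys m \<subseteq> t"
    proof (rule ccontr)
      assume "\<not> ?thesis"
      \<comment> \<open>If the complement of the support is a non-face, it contains a minimal one.\<close>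
      then have "- Poly_Mapping.keys m \<in> {X. \<forall>t\<in>\<T>. \<not> X \<subseteq> t}" by simp
      from finite_has_minimal2[OF finite this]
      obtain X where X: "X \<subseteq> - Poly_Mapping.keys m" "\<forall>t\<in>\<T>. \<not> X \<subseteq> t"
        and min: "\<forall>Y\<in>{X. \<forall>t\<in>\<T>. \<not> X \<subseteq> t}. Y \<subseteq> X \<longrightarrow> X = Y"
        by blast
      have X_min: "\<exists>t\<in>\<T>. Y \<subseteq> t" if "Y \<subset> X" for Y using min that by blast
      have "squarefree_exponent X \<in> minimal_generators I"
        unfolding minimal_generators_def
      proof (intro CollectI conjI allI impI; (elim conjE)?)
        show "monomial (squarefree_exponent X) \<in> I" using X(2) by (simp add: I keys_squarefree_exponent)
        fix m' assume m': "monomial m' \<in> I" "(monomial m' :: ('v, 'k) mpoly) dvd monomial (squarefree_exponent X)"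
        have le: "Poly_Mapping.lookup m' v \<le> (if v \<in> X then 1 else 0)" for v
          using monomial_dvd_imp_le[OF m'(2), of v] by (simp add: lookup_squarefree_exponent)
        have "Poly_Mapping.keys m' \<subseteq> X"
        proof
          fix v assume "v \<in> Poly_Mapping.keys m'"
          then show "v \<in> X" using le[of v] by (auto simp: in_keys_iff split: if_splits)
        qed
        moreover have "\<not> Poly_Mapping.keys m' \<subset> X" using X_min m'(1) by (auto simp: I)
        ultimately have "Poly_Mapping.keys m' = X" by blast
        show "m' = squarefree_exponent X"
        proof (intro poly_mapping_eqI)
          fix v
          show "Poly_Mapping.lookup m' v = Poly_Mapping.lookup (squarefree_exponent X) v"
            using le[of v] \<open>Poly_Mapping.keys m' = X\<close> in_keys_iff[of v m']
            by (cases "v \<in> X") (simp_all add: lookup_squarefree_exponent)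
        qed
      qed
      then have "f \<in> ideal.span (var ` X)"
        using f by (force simp: alexander_dual_def keys_squarefree_exponent)
      from keys_meet_if_in_span_vars[OF this m] X(1) show False by blast
    qed
    then obtain t where t: "t \<in> \<T>" "- Poly_Mapping.keys m \<subseteq> t" by blast
    have "monomial (squarefree_exponent (- t)) \<in> ideal.span ?B" using t(1) by (intro ideal.span_base) auto
    then show "monomial m \<in> ideal.span ?B"
      by (rule monomial_in_ideal_mono)
        (use t(2) in \<open>auto simp: lookup_squarefree_exponent in_keys_iff Suc_le_eq\<close>)
  qed
next
  have "?B \<subseteq> ideal.span (var ` Poly_Mapping.keys m)" if "m \<in> minimal_generators I" for m
  proof clarify
    fix t assume "t \<in> \<T>"
    with that obtain v where v: "v \<in> Poly_Mapping.keys m" "v \<notin> t"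
      by (auto simp: minimal_generators_def I)
    have "(var v :: ('v, 'k) mpoly) \<in> ideal.span (var ` Poly_Mapping.keys m)"
      using v(1) by (intro ideal.span_base) auto
    then show "(monomial (squarefree_exponent (- t)) :: ('v, 'k) mpoly) \<in> ideal.span (var ` Poly_Mapping.keys m)"
      unfolding var_def
      by (rule monomial_in_ideal_mono)
        (use v(2) in \<open>auto simp: lookup_squarefree_exponent lookup_single when_def\<close>)
  qed
  then have "ideal.span ?B \<subseteq> alexander_dual I"
    unfolding alexander_dual_def by (intro INT_greatest ideal.span_minimal) auto
  then show "f \<in> alexander_dual I" if "f \<in> ideal.span ?B" for f using that by blast
qed

lemma matrix_monomial_fine_cotype:
  assumes "\<And>i. torus_point (w i) = V i"
  shows "matrix_monomial (fine_cotype V (torus_point q))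
    = (monomial (squarefree_exponent (- tight_entries w q)) :: ('n::finite \<times> 'd::finite, 'k::field) mpoly)"
proof -
  have "V = (\<lambda>i. torus_point (w i))" using assms by auto
  then have "{(i, j). fine_cotype V (torus_point q) $ i $ j = 1} = - tight_entries w q"
    by (auto simp: fine_cotype_def fine_type_def sector_def max_sector.abs_eq tight_entries_def split: if_splits)
  then show ?thesis by (simp add: matrix_monomial_eq)
qed

theorem corollary6p8:
  fixes V :: "'n::finite \<Rightarrow> 'd::finite torus"
    and w :: "'n \<Rightarrow> real ^ 'd"
    and J :: "('n \<times> 'd, 'k::field) mpoly set"
  assumes "\<And>i. torus_point (w i) = V i"
    and "J = initial_ideal w minors_ideal"
  shows "squarefree_monomial_ideal (largest_monomial_ideal J) \<and>
         alexander_dual (largest_monomial_ideal J) = fine_cotype_ideal V"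
proof
  let ?M = "largest_monomial_ideal J"
  have in_J: "monomial m \<in> J \<longleftrightarrow> (\<forall>t\<in>range (tight_entries w). \<not> Poly_Mapping.keys m \<subseteq> t)" for m
    by (simp add: assms(2) monomial_in_initial_ideal_iff minimal_weight_iff)
  have "?M \<subseteq> J"
    unfolding largest_monomial_ideal_def assms(2) initial_ideal_def
    by (intro ideal.span_minimal) auto
  then have in_M: "monomial m \<in> ?M \<longleftrightarrow> (\<forall>t\<in>range (tight_entries w). \<not> Poly_Mapping.keys m \<subseteq> t)" for m
    unfolding in_J[symmetric] largest_monomial_ideal_def by (meson IntI ideal.span_base rangeI subsetD)

  define S where "S = squarefree_exponent ` {X. \<forall>t\<in>range (tight_entries w). \<not> X \<subseteq> t}"
  have "monomial m \<in> ideal.span (monomial ` S)" if "monomial m \<in> J" for m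
  proof -
    have "squarefree_exponent (Poly_Mapping.keys m) \<in> S" using that by (auto simp: S_def in_J)
    then have "monomial (squarefree_exponent (Poly_Mapping.keys m)) \<in> ideal.span (monomial ` S)"
      by (intro ideal.span_base) auto
    then show ?thesis
      by (rule monomial_in_ideal_mono) (auto simp: lookup_squarefree_exponent in_keys_iff Suc_le_eq)
  qed
  then have "?M \<subseteq> ideal.span (monomial ` S)"
    unfolding largest_monomial_ideal_def by (intro ideal.span_minimal) auto
  moreover have "ideal.span (monomial ` S) \<subseteq> ?M"
    unfolding largest_monomial_ideal_def
    by (intro ideal.span_mono) (auto simp: S_def in_J keys_squarefree_exponent)
  moreover have "\<forall>m\<in>S. \<forall>v. Poly_Mapping.lookup m v \<le> 1"
    by (auto simp: S_def lookup_squarefree_exponent)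
  ultimately show "squarefree_monomial_ideal ?M"
    unfolding squarefree_monomial_ideal_def by (intro exI[of _ S]) auto

  have "{matrix_monomial (fine_cotype V p) | p. True}
      = {monomial (squarefree_exponent (- t)) :: ('n \<times> 'd, 'k) mpoly | t. t \<in> range (tight_entries w)}"
    (is "?L = ?R")
  proof (intro equalityI subsetI)
    fix x assume "x \<in> ?L"
    then obtain p where "x = matrix_monomial (fine_cotype V p)" by blast
    moreover have "p = torus_point (rep_torus p)"
      by (rule Quotient3_abs_rep[OF Quotient3_torus, symmetric])
    ultimately have "x = monomial (squarefree_exponent (- tight_entries w (rep_torus p)))"
      using matrix_monomial_fine_cotype[of w V "rep_torus p", OF assms(1)] by metis
    then show "x \<in> ?R" by blast
  next
    fix x assume "x \<in> ?R"
    then obtain q where "x = monomial (squarefree_exponent (- tight_entries w q))" by blast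
    then have "x = matrix_monomial (fine_cotype V (torus_point q))"
      using matrix_monomial_fine_cotype[of w V q, OF assms(1)] by metis
    then show "x \<in> ?L" by blast
  qed
  then show "alexander_dual ?M = fine_cotype_ideal V"
    unfolding alexander_dual_of_face_ideal[OF in_M] fine_cotype_ideal_def by simp
qed

end
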